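(* Let $p_1,\ldots,p_n$ be relatively prime positive integers and let $p=(p_1,\ldots,p_n)$. Let $I_{\mathcal L}$ be the lattice ideal and $\leq$ the term order defined in the context. For every $t\in\mathbb{N}$, the $p$-weighted Hilbert function satisfies $\mathrm{HF}_{\mathrm{in}_\leq(I_{\mathcal L})}(t)=1$ if $t$ is $p$-representable, and $\mathrm{HF}_{\mathrm{in}_\leq(I_{\mathcal L})}(t)=0$ otherwise.
   Context: $\mathbb{N}$ includes $0$. "Relatively prime" means $\gcd(p_1,\ldots,p_n)=1$ (not necessarily pairwise coprime). An integer $t$ is $p$-representable if $t=v\cdot p$ for some $v\in\mathbb{N}^n$. The $p$-degree of $v\in\mathbb{Z}^n$ is $v\cdot p$. For $v\in\mathbb{Z}^n$, $v^+\in\mathbb{N}^n$ is given by $v^+_i=\max(v_i,0)$ and $v^-:=(-v)^+$. For $v\in\mathbb{N}^n$, $x^v=x_1^{v_1}\cdots x_n^{v_n}$ in the polynomial ring $k[x_1,\ldots,x_n]$ over a field $k$. The lattice ideal is $I_{\mathcal L}=\langle x^{v^+}-x^{v^-} \mid v\in\mathbb{Z}^n,\ v\cdot p=0\rangle$. The term order $\leq$ first compares the $p$-degree of exponent vectors, and breaks ties by the reverse lexicographic order with $x_1<x_2<\cdots<x_n$: if $u\ne v$ have equal $p$-degree, then $x^u<x^v$ iff $u_i>v_i$ for the smallest index $i$ with $u_i\neq v_i$. $\mathrm{in}_\leq(I_{\mathcal L})$ is the initial ideal. The $p$-weighted Hilbert function $\mathrm{HF}_I\colon\mathbb{N}\to\mathbb{N}$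 of a monomial ideal $I$ is: $\mathrm{HF}_I(t)$ is the number of monomials $x^m\notin I$ such that $m$ has $p$-degree $t$. *)

theory Defs
  imports Complex_Main "HOL-Library.Poly_Mapping"
begin

(* The variables are indexed by a finite linearly ordered type 'n, whose order is the order
   of the indices 1 < ... < n.  Exponent vectors are elements of 'n \<Rightarrow>\<^sub>0 nat, and the
   polynomial ring over 'k is the type ('n \<Rightarrow>\<^sub>0 nat) \<Rightarrow>\<^sub>0 'k with the convolution product of
   the library. *)

(* Used on vectors over nat and over int. *)
definition p_degree :: "('n::finite \<Rightarrow> nat) \<Rightarrow> ('n \<Rightarrow>\<^sub>0 'a::comm_semiring_1) \<Rightarrow> 'a" where
  "p_degree p v = (\<Sum>i\<in>UNIV. Poly_Mapping.lookup v i * of_nat (p i))"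

definition p_representable :: "('n::finite \<Rightarrow> nat) \<Rightarrow> int \<Rightarrow> bool" where
  "p_representable p t \<longleftrightarrow> (\<exists>v :: 'n \<Rightarrow>\<^sub>0 nat. t = int (p_degree p v))"

(* The coercion nat truncates negative integers to 0, so the entries are max (v i) 0. *)
definition pos_part :: "('n \<Rightarrow>\<^sub>0 int) \<Rightarrow> ('n \<Rightarrow>\<^sub>0 nat)" where
  "pos_part v = Poly_Mapping.map nat v"

definition neg_part :: "('n \<Rightarrow>\<^sub>0 int) \<Rightarrow> ('n \<Rightarrow>\<^sub>0 nat)" where
  "neg_part v = pos_part (- v)"

definition monomial :: "('n \<Rightarrow>\<^sub>0 nat) \<Rightarrow> (('n \<Rightarrow>\<^sub>0 nat) \<Rightarrow>\<^sub>0 'k::comm_ring_1)" where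
  "monomial v = Poly_Mapping.single v 1"

(* The span in the ring regarded as a module over itself. *)
definition ideal_generated :: "'a::comm_ring_1 set \<Rightarrow> 'a set" where
  "ideal_generated S = module.span (*) S"

definition lattice_ideal :: "('n::finite \<Rightarrow> nat) \<Rightarrow> (('n \<Rightarrow>\<^sub>0 nat) \<Rightarrow>\<^sub>0 'k::field) set" where
  "lattice_ideal p = ideal_generated
     {monomial (pos_part v) - monomial (neg_part v) | v :: 'n \<Rightarrow>\<^sub>0 int. p_degree p v = 0}"

definition term_less ::
  "('n::{finite,linorder} \<Rightarrow> nat) \<Rightarrow> ('n \<Rightarrow>\<^sub>0 nat) \<Rightarrow> ('n \<Rightarrow>\<^sub>0 nat) \<Rightarrow> bool" where
  "term_less p u v \<longleftrightarrow>
     p_degree p u < p_degree p v \<or>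
     p_degree p u = p_degree p v \<and>
       (\<exists>i. Poly_Mapping.lookup u i > Poly_Mapping.lookup v i \<and>
            (\<forall>j<i. Poly_Mapping.lookup u j = Poly_Mapping.lookup v j))"

definition term_le ::
  "('n::{finite,linorder} \<Rightarrow> nat) \<Rightarrow> ('n \<Rightarrow>\<^sub>0 nat) \<Rightarrow> ('n \<Rightarrow>\<^sub>0 nat) \<Rightarrow> bool" where
  "term_le p u v \<longleftrightarrow> u = v \<or> term_less p u v"

(* For a total order le on exponent vectors such an m exists precisely for f \<noteq> 0, and it is then
   unique. *)
definition is_initial_exponent ::
  "(('n \<Rightarrow>\<^sub>0 nat) \<Rightarrow> ('n \<Rightarrow>\<^sub>0 nat) \<Rightarrow> bool) \<Rightarrow> (('n \<Rightarrow>\<^sub>0 nat) \<Rightarrow>\<^sub>0 'k::zero) \<Rightarrow> ('n \<Rightarrow>\<^sub>0 nat) \<Rightarrow> bool"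
  where
  "is_initial_exponent le f m \<longleftrightarrow>
     m \<in> Poly_Mapping.keys f \<and> (\<forall>u \<in> Poly_Mapping.keys f. le u m)"

definition initial_ideal ::
  "(('n \<Rightarrow>\<^sub>0 nat) \<Rightarrow> ('n \<Rightarrow>\<^sub>0 nat) \<Rightarrow> bool) \<Rightarrow>
   (('n \<Rightarrow>\<^sub>0 nat) \<Rightarrow>\<^sub>0 'k::field) set \<Rightarrow> (('n \<Rightarrow>\<^sub>0 nat) \<Rightarrow>\<^sub>0 'k) set" where
  "initial_ideal le I = ideal_generated {monomial m | f m. f \<in> I \<and> is_initial_exponent le f m}"

(* If all p i are positive, then there are only finitely many m of any given p-degree, so the
   cardinality is a genuine count. *)
definition weighted_HF ::
  "('n::finite \<Rightarrow> nat) \<Rightarrow> (('n \<Rightarrow>\<^sub>0 nat) \<Rightarrow>\<^sub>0 'k::field) set \<Rightarrow> nat \<Rightarrow> nat" where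
  "weighted_HF p I t = card {m :: 'n \<Rightarrow>\<^sub>0 nat. monomial m \<notin> I \<and> p_degree p m = t}"

end

theory Submission
  imports Defs "HOL-Library.FuncSet"
begin

text \<open>
  Two exponent vectors of the same \<open>p\<close>-degree differ by a lattice vector, so the difference of
  their monomials lies in the lattice ideal. Hence only the least vector of a degree can give a
  standard monomial. Conversely, for every polynomial of the lattice ideal and every degree, the
  coefficients in that degree sum to zero. So an initial exponent is never the only exponent of
  its degree; the least vector of a degree is thus not a multiple of an initial exponent.
\<close>

text \<open>An ideal is a span over the ring acting on itself, so this interpretation makes the
  library's span rules available for \<open>ideal_generated\<close>.\<close>

lemma module_mult: "module ((*) :: 'a::comm_ring_1 \<Rightarrow> 'a \<Rightarrow> 'a)"
  by unfold_locales (simp_all add: algebra_simps)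

lemma ideal_generated_base: "x \<in> S \<Longrightarrow> x \<in> ideal_generated S"
  unfolding ideal_generated_def by (rule module.span_base[OF module_mult])

lemma ideal_generated_mult: "x \<in> ideal_generated S \<Longrightarrow> c * x \<in> ideal_generated S"
  unfolding ideal_generated_def by (rule module.span_scale[OF module_mult])

lemma ideal_generated_induct [consumes 1, case_names zero add]:
  assumes "x \<in> ideal_generated S"
    and "P 0" and "\<And>c x y. x \<in> S \<Longrightarrow> P y \<Longrightarrow> P (c * x + y)"
  shows "P x"
  using module.span_induct_alt[OF module_mult, of x S P] assms
  by (auto simp: ideal_generated_def)

text \<open>Updating at a key outside the support is the same as adding a \<open>single\<close>.
  This form of induction suits properties preserved under sums.\<close>

lemma poly_mapping_single_induct [case_names zero add]:
  assumes "P 0" and "\<And>f a b. P f \<Longrightarrow> P (Poly_Mapping.single a b + f)"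
  shows "P f"
proof (induction f rule: update_induct)
  case const
  show ?case by (fact assms(1))
next
  case (update f a b)
  then have "Poly_Mapping.update a b f = Poly_Mapping.single a b + f"
    by (intro poly_mapping_eqI) (auto simp: lookup_update lookup_add lookup_single in_keys_iff)
  then show ?case
    using assms(2)[OF update.IH] by simp
qed

lemma p_degree_add: "p_degree p (u + v) = p_degree p u + p_degree p v"
  by (simp add: p_degree_def lookup_add algebra_simps sum.distrib)

lemma lookup_pos_part: "Poly_Mapping.lookup (pos_part v) i = nat (Poly_Mapping.lookup v i)"
  by (simp add: pos_part_def map.rep_eq when_def)

lemma lookup_neg_part: "Poly_Mapping.lookup (neg_part v) i = nat (- Poly_Mapping.lookup v i)"
  by (simp add: neg_part_def lookup_pos_part)

text \<open>Entrywise \<open>v\<close> is its positive part minus its negative part. Hence both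
  monomials of a generator of the lattice ideal have the same degree.\<close>

lemma p_degree_pos_part_diff_neg_part:
  "int (p_degree p (pos_part v)) - int (p_degree p (neg_part v)) = p_degree p v"
proof -
  have "p_degree p v = (\<Sum>i\<in>UNIV. int (nat (Poly_Mapping.lookup v i)) * int (p i)
      - int (nat (- Poly_Mapping.lookup v i)) * int (p i))"
    unfolding p_degree_def by (rule sum.cong) (simp_all split: split_nat)
  then show ?thesis
    by (simp add: p_degree_def lookup_pos_part lookup_neg_part sum_subtractf)
qed

text \<open>Taking out the greatest common monomial factor leaves the generator that belongs to the
  integer vector \<open>a - b\<close>.\<close>

lemma monomial_diff_in_lattice_ideal:
  fixes a b :: "'n::finite \<Rightarrow>\<^sub>0 nat"
  assumes "p_degree p a = p_degree p b"
  shows "monomial a - monomial b \<in> (lattice_ideal p :: (('n \<Rightarrow>\<^sub>0 nat) \<Rightarrow>\<^sub>0 'k::field) set)"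
proof -
  define v where "v = Poly_Mapping.map int a - Poly_Mapping.map int b"
  have v: "Poly_Mapping.lookup v i = int (Poly_Mapping.lookup a i) - int (Poly_Mapping.lookup b i)" for i
    by (simp add: v_def lookup_minus map.rep_eq when_def)
  \<comment> \<open>Subtraction on \<open>nat\<close> truncates, but here nothing is lost:
    \<open>a - pos_part v\<close> is the entrywise minimum of \<open>a\<close> and
    \<open>b\<close>.\<close>
  have a: "a = (a - pos_part v) + pos_part v"
    by (rule poly_mapping_eqI) (auto simp: lookup_add lookup_minus lookup_pos_part v)
  have b: "b = (a - pos_part v) + neg_part v"
    by (rule poly_mapping_eqI) (auto simp: lookup_add lookup_minus lookup_pos_part lookup_neg_part v)
  have "p_degree p v = int (p_degree p a) - int (p_degree p b)"
    by (simp add: p_degree_def v left_diff_distrib sum_subtractf)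
  then have "p_degree p v = 0"
    using assms by simp
  then have "monomial (pos_part v) - monomial (neg_part v) \<in> (lattice_ideal p :: (('n \<Rightarrow>\<^sub>0 nat) \<Rightarrow>\<^sub>0 'k) set)"
    unfolding lattice_ideal_def by (intro ideal_generated_base) auto
  then have "monomial (a - pos_part v) * (monomial (pos_part v) - monomial (neg_part v))
      \<in> (lattice_ideal p :: (('n \<Rightarrow>\<^sub>0 nat) \<Rightarrow>\<^sub>0 'k) set)"
    unfolding lattice_ideal_def by (rule ideal_generated_mult)
  also have "monomial (a - pos_part v) * (monomial (pos_part v) - monomial (neg_part v))
      = (monomial a - monomial b :: ('n \<Rightarrow>\<^sub>0 nat) \<Rightarrow>\<^sub>0 'k)"
    unfolding right_diff_distrib monomial_def mult_single a[symmetric] b[symmetric] by simp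
  finally show ?thesis .
qed

text \<open>Positive weights bound every entry by \<open>d\<close>, so the vectors lie in a finite
  box.\<close>

lemma finite_p_degree_eq:
  fixes p :: "'n::finite \<Rightarrow> nat"
  assumes "\<And>i. p i > 0"
  shows "finite {m :: 'n \<Rightarrow>\<^sub>0 nat. p_degree p m = d}"
proof -
  have "Poly_Mapping.lookup m i \<le> d" if "p_degree p m = d" for m :: "'n \<Rightarrow>\<^sub>0 nat" and i
  proof -
    have "Poly_Mapping.lookup m i \<le> Poly_Mapping.lookup m i * p i"
      using assms[of i] by simp
    also have "\<dots> \<le> (\<Sum>j\<in>UNIV. Poly_Mapping.lookup m j * p j)"
      by (rule member_le_sum) auto
    finally show ?thesis
      using that by (simp add: p_degree_def)
  qed
  then have "Poly_Mapping.lookup ` {m :: 'n \<Rightarrow>\<^sub>0 nat. p_degree p m = d} \<subseteq> PiE UNIV (\<lambda>_. {..d})"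
    by auto
  then have "finite (Poly_Mapping.lookup ` {m :: 'n \<Rightarrow>\<^sub>0 nat. p_degree p m = d})"
    by (rule finite_subset) (auto intro: finite_PiE)
  then show ?thesis
    by (rule finite_imageD) (simp add: inj_on_def lookup_inject)
qed

text \<open>Substituting \<open>T^(p i)\<close> for the variable with index \<open>i\<close> sends
  every lattice binomial to 0; the sum is the coefficient of \<open>T^d\<close> in the image of
  \<open>f\<close>. The proof works with this coefficient directly, as a linear functional
  \<open>\<phi>\<close>.\<close>

lemma lattice_ideal_coeff_sum_zero:
  fixes p :: "'n::finite \<Rightarrow> nat" and f :: "('n \<Rightarrow>\<^sub>0 nat) \<Rightarrow>\<^sub>0 'k::field"
  assumes pos: "\<And>i. p i > 0" and "f \<in> lattice_ideal p"
  shows "(\<Sum>m | p_degree p m = d. Poly_Mapping.lookup f m) = 0"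
proof -
  define \<phi> :: "(('n \<Rightarrow>\<^sub>0 nat) \<Rightarrow>\<^sub>0 'k) \<Rightarrow> 'k"
    where "\<phi> f = (\<Sum>m | p_degree p m = d. Poly_Mapping.lookup f m)" for f
  have zero: "\<phi> 0 = 0"
    by (simp add: \<phi>_def)
  have add: "\<phi> (f + g) = \<phi> f + \<phi> g" for f g
    by (simp add: \<phi>_def lookup_add sum.distrib)
  have diff: "\<phi> (f - g) = \<phi> f - \<phi> g" for f g
    by (simp add: \<phi>_def lookup_minus sum_subtractf)
  \<comment> \<open>Finiteness of the degree class matters here: over an infinite set
    \<open>sum\<close> would be 0 by convention.\<close>
  have single: "\<phi> (Poly_Mapping.single a c) = (if p_degree p a = d then c else 0)" for a c
    using finite_p_degree_eq[of p d] pos by (simp add: \<phi>_def lookup_single when_def)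
  \<comment> \<open>By linearity \<open>c\<close> may be a single term. Its products with the two
    monomials have equal degree and opposite coefficients, so they cancel under
    \<open>\<phi>\<close>.\<close>
  have mult: "\<phi> (c * (monomial a - monomial b)) = 0" if "p_degree p a = p_degree p b" for a b c
  proof (induction c rule: poly_mapping_single_induct)
    case zero
    show ?case by (simp add: \<open>\<phi> 0 = 0\<close>)
  next
    case (add g w k)
    then show ?case
      by (simp add: \<open>\<And>f g. \<phi> (f + g) = \<phi> f + \<phi> g\<close> diff single distrib_right right_diff_distrib
          monomial_def mult_single p_degree_add that)
  qed
  have "\<phi> f = 0"
    using \<open>f \<in> lattice_ideal p\<close> unfolding lattice_ideal_def
  proof (induction f rule: ideal_generated_induct)
    case zero
    show ?case by (simp add: \<open>\<phi> 0 = 0\<close>)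
  next
    case (add c x y)
    then obtain v :: "'n \<Rightarrow>\<^sub>0 int"
      where "x = monomial (pos_part v) - monomial (neg_part v)" and "p_degree p v = 0"
      by auto
    then show ?case
      using p_degree_pos_part_diff_neg_part[of p v] \<open>\<phi> y = 0\<close> mult
      by (simp add: \<open>\<And>f g. \<phi> (f + g) = \<phi> f + \<phi> g\<close>)
  qed
  then show ?thesis
    by (simp add: \<phi>_def)
qed

text \<open>All exponents of \<open>c * monomial u\<close> have the form \<open>w + u\<close>, and a
  sum has no exponents beyond those of its summands.\<close>

lemma keys_monomial_ideal:
  assumes "f \<in> ideal_generated (monomial ` U)" and "m \<in> Poly_Mapping.keys f"
  shows "\<exists>u\<in>U. \<exists>w. m = w + u"
  using assms
proof (induction f rule: ideal_generated_induct)
  case zero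
  then show ?case by simp
next
  case (add c x y)
  from \<open>x \<in> monomial ` U\<close> obtain u where u: "u \<in> U" "x = monomial u"
    by blast
  have "m \<in> Poly_Mapping.keys (c * x) \<union> Poly_Mapping.keys y"
    using add.prems keys_add[of "c * x" y] by (rule rev_subsetD)
  moreover have "\<exists>w. m = w + u" if "m \<in> Poly_Mapping.keys (c * x)"
  proof -
    have "Poly_Mapping.keys x \<subseteq> {u}"
      by (simp add: u monomial_def)
    with that keys_mult[of c x] show ?thesis
      by blast
  qed
  ultimately show ?case
    using add.IH u(1) by blast
qed

text \<open>Within one degree the term order is the reverse of the library's order on \<open>\<Rightarrow>\<^sub>0\<close>.\<close>

lemma term_less_iff:
  "term_less p u v \<longleftrightarrow> p_degree p u < p_degree p v \<or> p_degree p u = p_degree p v \<and> v < u"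
  unfolding term_less_def less_poly_mapping.rep_eq less_fun_def by auto

text \<open>A larger \<open>m'\<close> makes \<open>m\<close> the initial exponent of a lattice
  binomial; conversely, vanishing coefficient sums force such a vector above each initial exponent,
  and translation carries it over to multiples.\<close>

lemma monomial_in_initial_ideal_iff:
  fixes p :: "'n::{finite,linorder} \<Rightarrow> nat"
  assumes pos: "\<And>i. p i > 0"
  shows "monomial m \<in> (initial_ideal (term_le p) (lattice_ideal p) :: (('n \<Rightarrow>\<^sub>0 nat) \<Rightarrow>\<^sub>0 'k::field) set)
    \<longleftrightarrow> (\<exists>m'. p_degree p m' = p_degree p m \<and> m < m')"
    (is "_ \<in> ?in \<longleftrightarrow> ?R")
proof
  assume ?R
  then obtain m' where m': "p_degree p m' = p_degree p m" "m < m'" by blast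
  let ?f = "monomial m - monomial m' :: ('n \<Rightarrow>\<^sub>0 nat) \<Rightarrow>\<^sub>0 'k"
  have "is_initial_exponent (term_le p) ?f m"
    using m' by (auto simp: is_initial_exponent_def term_le_def term_less_iff monomial_def
        in_keys_iff lookup_minus lookup_single when_def split: if_splits)
  moreover have "?f \<in> lattice_ideal p"
    using m' by (intro monomial_diff_in_lattice_ideal) simp
  ultimately show "monomial m \<in> ?in"
    unfolding initial_ideal_def by (intro ideal_generated_base) blast
next
  assume "monomial m \<in> ?in"
  moreover have "?in = ideal_generated (monomial `
      {u. \<exists>f :: ('n \<Rightarrow>\<^sub>0 nat) \<Rightarrow>\<^sub>0 'k. f \<in> lattice_ideal p \<and> is_initial_exponent (term_le p) f u})"
    unfolding initial_ideal_def by (rule arg_cong[where f = ideal_generated]) blast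
  moreover have "m \<in> Poly_Mapping.keys (monomial m :: ('n \<Rightarrow>\<^sub>0 nat) \<Rightarrow>\<^sub>0 'k)"
    by (simp add: monomial_def)
  ultimately obtain u w and f :: "('n \<Rightarrow>\<^sub>0 nat) \<Rightarrow>\<^sub>0 'k"
    where f: "f \<in> lattice_ideal p" "is_initial_exponent (term_le p) f u" and m: "m = w + u"
    using keys_monomial_ideal by blast
  have "\<exists>u'. p_degree p u' = p_degree p u \<and> u < u'"
  proof (rule ccontr)
    assume none: "\<nexists>u'. p_degree p u' = p_degree p u \<and> u < u'"
    \<comment> \<open>Another exponent \<open>u'\<close> of \<open>f\<close> in this degree would be
      below \<open>u\<close> for \<open>term_less\<close>, that is, above \<open>u\<close> in the
      library order. So the coefficient sum of this degree reduces to the nonzero coefficient at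
      \<open>u\<close>.\<close>
    have "Poly_Mapping.lookup f u' = 0" if "p_degree p u' = p_degree p u" "u' \<noteq> u" for u'
      using that f(2) none by (auto simp: is_initial_exponent_def term_le_def term_less_iff in_keys_iff)
    then have "(\<Sum>u' | p_degree p u' = p_degree p u. Poly_Mapping.lookup f u') = Poly_Mapping.lookup f u"
      using finite_p_degree_eq[of p "p_degree p u"] pos
      by (subst sum.remove[of _ u]) (auto intro!: sum.neutral)
    then show False
      using lattice_ideal_coeff_sum_zero[OF pos f(1)] f(2)
      by (simp add: is_initial_exponent_def in_keys_iff)
  qed
  then obtain u' where "p_degree p u' = p_degree p u" "u < u'" by blast
  \<comment> \<open>Adding \<open>w\<close> preserves both equality of degrees and the strict
    order.\<close>
  then have "p_degree p (w + u') = p_degree p m" "m < w + u'"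
    by (simp_all add: m p_degree_add)
  then show ?R by blast
qed

theorem proposition8:
  fixes p :: "'n::{finite,linorder} \<Rightarrow> nat" and t :: nat
  assumes "\<And>i. p i > 0"
    and "Gcd (range p) = 1"
  shows "weighted_HF p
           (initial_ideal (term_le p) (lattice_ideal p :: (('n \<Rightarrow>\<^sub>0 nat) \<Rightarrow>\<^sub>0 'k::field) set)) t
         = (if p_representable p (int t) then 1 else 0)"
proof -
  define F where "F = {m :: 'n \<Rightarrow>\<^sub>0 nat. p_degree p m = t}"
  have fin: "finite F"
    unfolding F_def by (rule finite_p_degree_eq) (fact assms(1))
  \<comment> \<open>Since the library order is linear, having no larger vector of the same degree
    means being greatest in \<open>F\<close>.\<close>
  have HF: "weighted_HF p
      (initial_ideal (term_le p) (lattice_ideal p :: (('n \<Rightarrow>\<^sub>0 nat) \<Rightarrow>\<^sub>0 'k) set)) t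
      = card {m \<in> F. \<forall>m'\<in>F. m' \<le> m}"
    unfolding weighted_HF_def
    by (rule arg_cong[where f = card])
      (auto simp: monomial_in_initial_ideal_iff[OF assms(1)] F_def not_less)
  have rep: "p_representable p (int t) \<longleftrightarrow> F \<noteq> {}"
    by (auto simp: p_representable_def F_def)
  show ?thesis
  proof (cases "F = {}")
    case True
    then show ?thesis by (simp add: HF rep)
  next
    case False
    \<comment> \<open>A nonempty finite linearly ordered set has exactly one greatest
      element.\<close>
    then have "{m \<in> F. \<forall>m'\<in>F. m' \<le> m} = {Max F}"
      using fin by (auto intro: Max_eqI[symmetric] Max_in)
    then show ?thesis using False by (simp add: HF rep)
  qed
qed

end
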